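(* Let $G$ be a connected $m$-vertex, $d$-regular graph (with $m\ge 2$ finite), and let $u\in V(G)$. For positive integers $n$ and $t\in[n]$, let $B_t:=\{u\}^t\times V(G)^{n-t}\subseteq V(G^n)$. (i) If $y_G=d$, then for every positive integer $n$ and every $t\in[n]$, the set $B_t$ has the smallest edge-boundary among all $m^{n-t}$-element sets of vertices of $G^n$, i.e. $e_{G^n}(B_t,B_t^c)\le e_{G^n}(A,A^c)$ for every $A\subseteq V(G^n)$ with $|A|=m^{n-t}$. (ii) For large enough $n$, the condition $y_G=d$ is also necessary: if $y_G<d$, then there is $n_0$ such that for every $n\ge n_0$ there exist $t\in[n]$ and a set $A\subseteq V(G^n)$ with $|A|=m^{n-t}$ and $e_{G^n}(A,A^c)<e_{G^n}(B_t,B_t^c)$.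
   Context: $\log$ is the natural logarithm and $[m]$ denotes $\{1,\dots,m\}$. For a graph $G$ and $A\subseteq V(G)$, $A^c = V(G)\setminus A$ and $e_G(A,A^c)$ is the number of edges of $G$ with exactly one endpoint in $A$. For an $m$-vertex graph $G$ and $k\in[m]$, $i_k(G) := \min\{e_G(A,A^c)/|A| : A\subseteq V(G),\ |A|=k\}$. $G^n$ denotes the product graph $G\square\cdots\square G$ ($n$ copies): its vertex set is $V(G)^n$ and its edges are all pairs $\{u,v\}$ for which there is an index $j\in[n]$ such that $u_jv_j\in E(G)$ and $u_l=v_l$ for all $l\neq j$. Definition of $y_G$: for every $k\in[m-1]$, let $\ell_k$ be the line $y=i_k(G)\cdot(\log m-x)/(\log m-\log k)$, which passes through $(\log k,i_k(G))$ and $(\log m,0)$. Let $k^*\in[m-1]$ be the smallest index $k$ such that $\ell_k$ has the largest (least negative) slope among $\ell_1,\dots,\ell_{m-1}$. Then $y_G$ is the $y$-intercept of $\ell_{k^*}$, i.e. $y_G=i_{k^*}(G)\cdot\log m/(\log m-\log k^* )$. Graphs are simple. *)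

theory Defs
  imports Complex_Main "HOL-Library.FuncSet"
begin

record 'a ugraph =
  verts :: "'a set"
  edges :: "'a set set"

definition finite_simple_graph :: "'a ugraph \<Rightarrow> bool" where
  "finite_simple_graph G \<longleftrightarrow>
     finite (verts G) \<and> (\<forall>e \<in> edges G. e \<subseteq> verts G \<and> card e = 2)"

definition connected_graph :: "'a ugraph \<Rightarrow> bool" where
  "connected_graph G \<longleftrightarrow> verts G \<noteq> {} \<and>
     (\<forall>x \<in> verts G. \<forall>y \<in> verts G. (x, y) \<in> {(v, w). {v, w} \<in> edges G}\<^sup>*)"

definition regular_graph :: "nat \<Rightarrow> 'a ugraph \<Rightarrow> bool" where
  "regular_graph d G \<longleftrightarrow> (\<forall>v \<in> verts G. card {w. {v, w} \<in> edges G} = d)"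

definition edge_boundary :: "'a ugraph \<Rightarrow> 'a set \<Rightarrow> nat" where
  "edge_boundary G A = card {e \<in> edges G. card (e \<inter> A) = 1}"

text \<open>Vertices of the \<open>n\<close>-th Cartesian power are the \<open>n\<close>-tuples of vertices, encoded as
  extensional functions on \<open>{1..n}\<close> (so that each tuple is represented exactly once).\<close>

definition graph_power :: "'a ugraph \<Rightarrow> nat \<Rightarrow> (nat \<Rightarrow> 'a) ugraph" where
  "graph_power G n =
     \<lparr> verts = {1..n} \<rightarrow>\<^sub>E verts G,
       edges = {{x, y} | x y.
                  x \<in> ({1..n} \<rightarrow>\<^sub>E verts G) \<and> y \<in> ({1..n} \<rightarrow>\<^sub>E verts G) \<and>
                  (\<exists>j \<in> {1..n}. {x j, y j} \<in> edges G \<and> (\<forall>l \<in> {1..n} - {j}. x l = y l))} \<rparr>"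

text \<open>The minimum is over a nonempty finite set whenever the graph is finite and
  \<open>1 \<le> k \<le> card (verts G)\<close>; it is only used for such \<open>k\<close>.\<close>

definition iso_const :: "'a ugraph \<Rightarrow> nat \<Rightarrow> real" where
  "iso_const G k =
     Min ((\<lambda>A. real (edge_boundary G A) / real (card A)) ` {A. A \<subseteq> verts G \<and> card A = k})"

definition iso_line :: "'a ugraph \<Rightarrow> nat \<Rightarrow> real \<Rightarrow> real" where
  "iso_line G k x =
     iso_const G k * (ln (real (card (verts G))) - x) / (ln (real (card (verts G))) - ln (real k))"

definition iso_slope :: "'a ugraph \<Rightarrow> nat \<Rightarrow> real" where
  "iso_slope G k = - iso_const G k / (ln (real (card (verts G))) - ln (real k))"

definition k_star :: "'a ugraph \<Rightarrow> nat" where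
  "k_star G = (LEAST k. k \<in> {1..card (verts G) - 1} \<and>
     (\<forall>j \<in> {1..card (verts G) - 1}. iso_slope G j \<le> iso_slope G k))"

definition y_intercept :: "'a ugraph \<Rightarrow> real" where
  "y_intercept G = iso_line G (k_star G) 0"

definition fixed_prefix :: "'a ugraph \<Rightarrow> 'a \<Rightarrow> nat \<Rightarrow> nat \<Rightarrow> (nat \<Rightarrow> 'a) set" where
  "fixed_prefix G u n t = {x \<in> {1..n} \<rightarrow>\<^sub>E verts G. \<forall>i \<in> {1..t}. x i = u}"

end

(* Every S satisfies e(S) >= (y_G / ln m) |S| (ln m - ln |S|), and this inequality tensorises by an
   entropy argument.  If y_G = d, then the sets B_t attain equality in it.  If y_G < d, then it is
   attained by some S with |S| > 1, and a product of copies of S and V, corrected to have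
   exactly the right size, beats B_t. *)
theory Submission
  imports Defs
begin

text \<open>The slope of the line for k is minus i_k / (ln m - ln k), so the largest slope belongs
  to the smallest such ratio, and y_G / ln m is the best constant in the inequality. The inequality
  survives products without loss because boundary and entropy split along the same lines: removing
  one coordinate cuts the boundary exactly into boundaries of slices and of fibres, while
  subadditivity of entropy bounds |A| ln |A| from below by the matching sums. The obstacle in the
  converse is arithmetic: |S|^a m^b is usually not a power of m, and no integer a need give density
  exactly m^(-t). The gain over B_t is (d - y_G) t per vertex. Rounding costs a fixed amount per
  vertex plus a part proportional to t, whose factor is made as small as desired by enlarging b
  before t is chosen. This is needed in only one dimension, since a counterexample there passes to
  all larger ones.\<close>

section \<open>Edge boundaries counted from the vertices inside\<close>

lemma edge_boundary_eq_sum: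
  assumes "finite_simple_graph H" "A \<subseteq> verts H"
  shows "edge_boundary H A = (\<Sum>x\<in>A. card {y. {x, y} \<in> edges H \<and> y \<notin> A})"
proof -
  have fin: "finite (verts H)" and edge: "\<And>e. e \<in> edges H \<Longrightarrow> e \<subseteq> verts H \<and> card e = 2"
    using assms(1) by (auto simp: finite_simple_graph_def)
  let ?P = "SIGMA x:A. {y. {x, y} \<in> edges H \<and> y \<notin> A}"
  have finA: "finite A" using fin assms(2) finite_subset by blast
  have finN: "finite {y. {x, y} \<in> edges H \<and> y \<notin> A}" for x
    by (rule finite_subset[OF _ fin]) (use edge in blast)
  \<comment> \<open>A boundary edge has exactly one endpoint in \<open>A\<close>, so it arises from
    exactly one ordered pair that starts in \<open>A\<close>.\<close>
  have "bij_betw (\<lambda>(x, y). {x, y}) ?P {e \<in> edges H. card (e \<inter> A) = 1}"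
  proof (rule bij_betw_imageI)
    show "inj_on (\<lambda>(x, y). {x, y}) ?P"
      by (auto simp: inj_on_def doubleton_eq_iff)
    show "(\<lambda>(x, y). {x, y}) ` ?P = {e \<in> edges H. card (e \<inter> A) = 1}"
    proof (intro equalityI subsetI)
      fix e assume "e \<in> (\<lambda>(x, y). {x, y}) ` ?P"
      then obtain x y where xy: "x \<in> A" "{x, y} \<in> edges H" "y \<notin> A" "e = {x, y}" by auto
      then have "e \<inter> A = {x}" by auto
      with xy show "e \<in> {e \<in> edges H. card (e \<inter> A) = 1}" by simp
    next
      fix e assume e: "e \<in> {e \<in> edges H. card (e \<inter> A) = 1}"
      then obtain x where x: "e \<inter> A = {x}" by (auto simp: card_1_singleton_iff)
      have "card e = 2" using e edge by blast
      then obtain p q where pq: "e = {p, q}" "p \<noteq> q" by (auto simp: card_2_iff)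
      have "x \<in> e" using x by blast
      with pq have "e = {x, if x = p then q else p} \<and> x \<noteq> (if x = p then q else p)" by auto
      then obtain y where y: "e = {x, y}" "x \<noteq> y" by blast
      then have "(x, y) \<in> ?P" using x e by auto
      then show "e \<in> (\<lambda>(x, y). {x, y}) ` ?P" using y by force
    qed
  qed
  then have "edge_boundary H A = card ?P"
    unfolding edge_boundary_def by (rule bij_betw_same_card[symmetric])
  also have "\<dots> = (\<Sum>x\<in>A. card {y. {x, y} \<in> edges H \<and> y \<notin> A})"
    using finA finN by (intro card_SigmaI) auto
  finally show ?thesis .
qed

lemma edge_boundary_verts:
  assumes "finite_simple_graph G"
  shows "edge_boundary G (verts G) = 0"
proof -
  have *: "{y. {x, y} \<in> edges G \<and> y \<notin> verts G} = {}" for x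
    using assms by (auto simp: finite_simple_graph_def)
  show ?thesis unfolding edge_boundary_eq_sum[OF assms order_refl] * by simp
qed

text \<open>The edge boundary in a power whose coordinates are indexed by an arbitrary finite set
  \<open>I\<close>: this makes induction on the dimension possible.\<close>

definition power_boundary :: "'a ugraph \<Rightarrow> 'i set \<Rightarrow> ('i \<Rightarrow> 'a) set \<Rightarrow> nat" where
  "power_boundary G I A =
     (\<Sum>x\<in>A. \<Sum>i\<in>I. card {w. {x i, w} \<in> edges G \<and> x(i := w) \<notin> A})"

lemma finite_simple_graph_power:
  assumes "finite_simple_graph G"
  shows "finite_simple_graph (graph_power G n)"
  unfolding finite_simple_graph_def
proof (intro conjI ballI)
  have fin: "finite (verts G)" and edge: "\<And>e. e \<in> edges G \<Longrightarrow> e \<subseteq> verts G \<and> card e = 2"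
    using assms by (auto simp: finite_simple_graph_def)
  show "finite (verts (graph_power G n))"
    using fin by (auto simp: graph_power_def intro!: finite_PiE)
  fix e assume "e \<in> edges (graph_power G n)"
  then obtain x y j where xy: "e = {x, y}" "x \<in> {1..n} \<rightarrow>\<^sub>E verts G" "y \<in> {1..n} \<rightarrow>\<^sub>E verts G"
    "{x j, y j} \<in> edges G"
    by (auto simp: graph_power_def)
  then show "e \<subseteq> verts (graph_power G n)" by (auto simp: graph_power_def)
  have "x j \<noteq> y j" using edge[OF xy(4)] by auto
  then show "card e = 2" using xy(1) by (auto simp: card_2_iff)
qed

text \<open>The neighbours of \<open>x\<close> in the power are its one-coordinate updates
  \<open>x(j := w)\<close>. As \<open>G\<close> has no loops, such an update really changes
  \<open>x\<close>, hence determines \<open>j\<close> and \<open>w\<close>, and no neighbour is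
  counted twice.\<close>

lemma edge_boundary_graph_power:
  assumes G: "finite_simple_graph G" and A: "A \<subseteq> verts (graph_power G n)"
  shows "edge_boundary (graph_power G n) A = power_boundary G {1..n} A"
proof -
  have fin: "finite (verts G)" and edge: "\<And>e. e \<in> edges G \<Longrightarrow> e \<subseteq> verts G \<and> card e = 2"
    using G by (auto simp: finite_simple_graph_def)
  have "card {y. {x, y} \<in> edges (graph_power G n) \<and> y \<notin> A}
      = (\<Sum>i\<in>{1..n}. card {w. {x i, w} \<in> edges G \<and> x(i := w) \<notin> A})" if "x \<in> A" for x
  proof -
    let ?N = "\<lambda>i. {w. {x i, w} \<in> edges G \<and> x(i := w) \<notin> A}"
    have x: "x \<in> {1..n} \<rightarrow>\<^sub>E verts G" using A that by (auto simp: graph_power_def)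
    have edge_iff: "{x, y} \<in> edges (graph_power G n) \<longleftrightarrow>
        (\<exists>j\<in>{1..n}. \<exists>w. {x j, w} \<in> edges G \<and> y = x(j := w))" for y
    proof
      assume "{x, y} \<in> edges (graph_power G n)"
      then obtain p q j where pq: "{x, y} = {p, q}" "p \<in> {1..n} \<rightarrow>\<^sub>E verts G"
          "q \<in> {1..n} \<rightarrow>\<^sub>E verts G" "j \<in> {1..n}" "{p j, q j} \<in> edges G"
          "\<forall>l\<in>{1..n} - {j}. p l = q l"
        by (auto simp: graph_power_def)
      from pq(1) have "x = p \<and> y = q \<or> x = q \<and> y = p" by (simp add: doubleton_eq_iff)
      then have y: "y \<in> {1..n} \<rightarrow>\<^sub>E verts G" "{x j, y j} \<in> edges G"
          "\<forall>l\<in>{1..n} - {j}. x l = y l"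
        using pq(2-6) by (metis insert_commute)+
      have "y = x(j := y j)"
      proof
        fix l show "y l = (x(j := y j)) l"
          using x y by (cases "l \<in> {1..n}") (auto simp: PiE_def extensional_def)
      qed
      then show "\<exists>j\<in>{1..n}. \<exists>w. {x j, w} \<in> edges G \<and> y = x(j := w)"
        using pq(4) y(2) by blast
    next
      assume "\<exists>j\<in>{1..n}. \<exists>w. {x j, w} \<in> edges G \<and> y = x(j := w)"
      then obtain j w where jw: "j \<in> {1..n}" "{x j, w} \<in> edges G" "y = x(j := w)" by blast
      then have "w \<in> verts G" using edge by blast
      then have y: "y \<in> {1..n} \<rightarrow>\<^sub>E verts G"
        using x jw by (auto simp: PiE_def extensional_def Pi_def)
      have "{x j, y j} \<in> edges G \<and> (\<forall>l\<in>{1..n} - {j}. x l = y l)" using jw by auto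
      then show "{x, y} \<in> edges (graph_power G n)"
        unfolding graph_power_def ugraph.select_convs mem_Collect_eq using x y jw(1) by blast
    qed
    have loopless: "{v, v} \<notin> edges G" for v using edge[of "{v, v}"] by auto
    have "{y. {x, y} \<in> edges (graph_power G n) \<and> y \<notin> A}
        = (\<lambda>(i, w). x(i := w)) ` (SIGMA i:{1..n}. ?N i)"
      unfolding edge_iff by (auto simp: image_iff)
    moreover have "inj_on (\<lambda>(i, w). x(i := w)) (SIGMA i:{1..n}. ?N i)"
    proof (rule inj_onI, clarsimp)
      fix i w i' w'
      assume *: "{x i, w} \<in> edges G" "{x i', w'} \<in> edges G" "x(i := w) = x(i' := w')"
      then have ne: "x i \<noteq> w" using loopless by auto
      have "(x(i := w)) i = (x(i' := w')) i" using *(3) by simp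
      with ne have "i = i'" by (auto split: if_splits)
      then show "i = i' \<and> w = w'" using *(3) by (metis fun_upd_same)
    qed
    moreover have "finite (?N i)" for i
      by (rule finite_subset[OF _ fin]) (use edge in blast)
    ultimately show ?thesis by (simp add: card_image card_SigmaI)
  qed
  then show ?thesis
    unfolding power_boundary_def edge_boundary_eq_sum[OF finite_simple_graph_power[OF G] A]
    by simp
qed

section \<open>Splitting off one coordinate; the entropy inequality\<close>

text \<open>For \<open>A\<close> over the index set \<open>insert i I\<close>, slices are sets over
  \<open>I\<close>, within reach of an induction hypothesis, and fibres are subsets of one copy of
  \<open>V\<close>, within reach of a hypothesis on \<open>G\<close> alone.\<close>

definition slice :: "'a set \<Rightarrow> 'i set \<Rightarrow> 'i \<Rightarrow> ('i \<Rightarrow> 'a) set \<Rightarrow> 'a \<Rightarrow> ('i \<Rightarrow> 'a) set" where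
  "slice V I i A v = {y \<in> I \<rightarrow>\<^sub>E V. y(i := v) \<in> A}"

definition fibre :: "'a set \<Rightarrow> 'i \<Rightarrow> ('i \<Rightarrow> 'a) set \<Rightarrow> ('i \<Rightarrow> 'a) \<Rightarrow> 'a set" where
  "fibre V i A y = {v \<in> V. y(i := v) \<in> A}"

lemma sum_slices:
  assumes "finite V" "finite I" "i \<notin> I" "A \<subseteq> insert i I \<rightarrow>\<^sub>E V"
  shows "sum f A = (\<Sum>v\<in>V. \<Sum>y\<in>slice V I i A v. f (y(i := v)))"
proof -
  have fin: "finite (I \<rightarrow>\<^sub>E V)" using assms by (auto intro!: finite_PiE)
  have img: "A = (\<lambda>(v, y). y(i := v)) ` (SIGMA v:V. slice V I i A v)"
  proof (intro equalityI subsetI)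
    fix x assume x: "x \<in> A"
    with assms(4) have "x \<in> (\<lambda>(y, g). g(i := y)) ` (V \<times> (I \<rightarrow>\<^sub>E V))"
      by (metis PiE_insert_eq subsetD)
    with x show "x \<in> (\<lambda>(v, y). y(i := v)) ` (SIGMA v:V. slice V I i A v)"
      by (auto simp: slice_def image_iff)
  qed (auto simp: slice_def)
  have inj: "inj_on (\<lambda>(v, y). y(i := v)) (SIGMA v:V. slice V I i A v)"
    by (rule inj_on_subset[OF inj_combinator[OF assms(3)]]) (auto simp: slice_def)
  have "sum f A = (\<Sum>(v, y)\<in>(SIGMA v:V. slice V I i A v). f (y(i := v)))"
    by (subst img, subst sum.reindex[OF inj]) (auto intro!: sum.cong)
  also have "\<dots> = (\<Sum>v\<in>V. \<Sum>y\<in>slice V I i A v. f (y(i := v)))"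
    using assms(1) fin by (intro sum.Sigma[symmetric]) (auto simp: slice_def)
  finally show ?thesis .
qed

lemma sum_fibres:
  assumes "finite V" "finite I" "i \<notin> I" "A \<subseteq> insert i I \<rightarrow>\<^sub>E V"
  shows "sum f A = (\<Sum>y\<in>I \<rightarrow>\<^sub>E V. \<Sum>v\<in>fibre V i A y. f (y(i := v)))"
proof -
  have fin: "finite (I \<rightarrow>\<^sub>E V)" using assms by (auto intro!: finite_PiE)
  show ?thesis
    unfolding sum_slices[OF assms] slice_def fibre_def
    by (rule sum.swap_restrict[OF assms(1) fin])
qed

text \<open>An edge of the power changes either a coordinate in \<open>I\<close>, and then stays in
  one slice, or the coordinate \<open>i\<close>, and then stays in one fibre.\<close>

lemma power_boundary_insert:
  assumes G: "finite_simple_graph G" and "finite I" "i \<notin> I" "A \<subseteq> insert i I \<rightarrow>\<^sub>E verts G"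
  shows "power_boundary G (insert i I) A =
    (\<Sum>v\<in>verts G. power_boundary G I (slice (verts G) I i A v)) +
    (\<Sum>y\<in>I \<rightarrow>\<^sub>E verts G. edge_boundary G (fibre (verts G) i A y))"
proof -
  let ?V = "verts G"
  have fin: "finite ?V" and edge: "\<And>e. e \<in> edges G \<Longrightarrow> e \<subseteq> ?V \<and> card e = 2"
    using G by (auto simp: finite_simple_graph_def)
  let ?g = "\<lambda>x j. card {w. {x j, w} \<in> edges G \<and> x(j := w) \<notin> A}"
  note sums = sum_slices[OF fin assms(2-4)] sum_fibres[OF fin assms(2-4)]
  have "power_boundary G (insert i I) A = (\<Sum>x\<in>A. \<Sum>j\<in>I. ?g x j) + (\<Sum>x\<in>A. ?g x i)"
    unfolding power_boundary_def using assms(2,3) by (simp add: sum.distrib add.commute)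
  also have "(\<Sum>x\<in>A. \<Sum>j\<in>I. ?g x j) = (\<Sum>v\<in>?V. power_boundary G I (slice ?V I i A v))"
    unfolding sums(1)[of "\<lambda>x. \<Sum>j\<in>I. ?g x j"] power_boundary_def
  proof (intro sum.cong refl)
    fix v y j assume v: "v \<in> ?V" and y: "y \<in> slice ?V I i A v" and j: "j \<in> I"
    have ne: "j \<noteq> i" using j assms(3) by auto
    \<comment> \<open>A tuple could also miss the slice by leaving the product set altogether;
      adjacency in \<open>G\<close> excludes this.\<close>
    have "y(j := w) \<in> I \<rightarrow>\<^sub>E ?V" if "{y j, w} \<in> edges G" for w
    proof -
      have "w \<in> ?V" using edge[OF that] by auto
      then show ?thesis using y j unfolding slice_def by (auto simp: PiE_def extensional_def)
    qed
    then have "{w. {(y(i := v)) j, w} \<in> edges G \<and> y(i := v, j := w) \<notin> A}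
        = {w. {y j, w} \<in> edges G \<and> y(j := w) \<notin> slice ?V I i A v}"
      using ne unfolding slice_def by (auto simp: fun_upd_twist)
    then show "?g (y(i := v)) j = card {w. {y j, w} \<in> edges G \<and> y(j := w) \<notin> slice ?V I i A v}"
      by simp
  qed
  also have "(\<Sum>x\<in>A. ?g x i) = (\<Sum>y\<in>I \<rightarrow>\<^sub>E ?V. edge_boundary G (fibre ?V i A y))"
    unfolding sums(2)[of "\<lambda>x. ?g x i"]
  proof (intro sum.cong refl)
    fix y
    have F: "fibre ?V i A y \<subseteq> ?V" by (auto simp: fibre_def)
    show "(\<Sum>v\<in>fibre ?V i A y. ?g (y(i := v)) i) = edge_boundary G (fibre ?V i A y)"
      unfolding edge_boundary_eq_sum[OF G F]
    proof (intro sum.cong refl arg_cong[where f = card] Collect_cong)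
      fix v w
      show "({(y(i := v)) i, w} \<in> edges G \<and> y(i := v, i := w) \<notin> A)
          = ({v, w} \<in> edges G \<and> w \<notin> fibre ?V i A y)"
        using edge[of "{v, w}"] by (auto simp: fibre_def)
    qed
  qed
  finally show ?thesis .
qed

text \<open>Gibbs' inequality in disguise: the product of the two marginals, divided by \<open>|A|\<close>, has
  total mass at most \<open>|A|\<close>, so \<open>ln z \<le> z - 1\<close> shows that its logarithm averages to at most \<open>0\<close>.\<close>

lemma sum_marginals_ln_le:
  fixes A :: "('b \<times> 'c) set"
  assumes "finite X" "finite Y" "A \<subseteq> X \<times> Y"
  defines "a \<equiv> \<lambda>x. real (card {y \<in> Y. (x, y) \<in> A})"
    and "b \<equiv> \<lambda>y. real (card {x \<in> X. (x, y) \<in> A})"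
  shows "(\<Sum>x\<in>X. a x * ln (a x)) + (\<Sum>y\<in>Y. b y * ln (b y)) \<le> real (card A) * ln (real (card A))"
proof -
  have finA: "finite A" using assms finite_subset by blast
  have A1: "A = (SIGMA x:X. {y \<in> Y. (x, y) \<in> A})" using assms(3) by auto
  have s1: "sum f A = (\<Sum>x\<in>X. \<Sum>y\<in>{y \<in> Y. (x, y) \<in> A}. f (x, y))" for f :: "'b \<times> 'c \<Rightarrow> real"
    by (subst A1, subst sum.Sigma) (use assms in \<open>auto intro!: sum.cong\<close>)
  have s2: "sum f A = (\<Sum>y\<in>Y. \<Sum>x\<in>{x \<in> X. (x, y) \<in> A}. f (x, y))" for f :: "'b \<times> 'c \<Rightarrow> real"
    unfolding s1 by (rule sum.swap_restrict[OF assms(1,2)])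
  let ?N = "real (card A)"
  have e1: "(\<Sum>(x, y)\<in>A. ln (a x)) = (\<Sum>x\<in>X. a x * ln (a x))"
    unfolding s1 by (simp add: a_def)
  have e2: "(\<Sum>(x, y)\<in>A. ln (b y)) = (\<Sum>y\<in>Y. b y * ln (b y))"
    unfolding s2 by (simp add: b_def)
  have Na: "?N = (\<Sum>x\<in>X. a x)" using s1[of "\<lambda>_. 1"] by (simp add: a_def)
  have Nb: "?N = (\<Sum>y\<in>Y. b y)" using s2[of "\<lambda>_. 1"] by (simp add: b_def)
  have "(\<Sum>(x, y)\<in>A. ln (a x) + ln (b y) - ln ?N) \<le> (\<Sum>(x, y)\<in>A. a x * b y / ?N - 1)"
  proof (rule sum_mono, clarify)
    fix x y assume xy: "(x, y) \<in> A"
    then have "x \<in> X" "y \<in> Y" using assms(3) by auto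
    with xy have "a x > 0" "b y > 0" "?N > 0"
      using assms(1,2) finA by (auto simp: a_def b_def card_gt_0_iff)
    then have "ln (a x) + ln (b y) - ln ?N = ln (a x * b y / ?N)"
      by (simp add: ln_div ln_mult)
    also have "\<dots> \<le> a x * b y / ?N - 1"
      using \<open>a x > 0\<close> \<open>b y > 0\<close> \<open>?N > 0\<close> by (intro ln_le_minus_one) simp
    finally show "ln (a x) + ln (b y) - ln ?N \<le> a x * b y / ?N - 1" .
  qed
  also have "\<dots> = (\<Sum>(x, y)\<in>A. a x * b y) / ?N - ?N"
    by (simp add: case_prod_unfold sum_subtractf sum_divide_distrib)
  also have "\<dots> \<le> (\<Sum>(x, y)\<in>X \<times> Y. a x * b y) / ?N - ?N"
    using assms(1-3) by (intro diff_right_mono divide_right_mono sum_mono2) (auto simp: a_def b_def)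
  also have "(\<Sum>(x, y)\<in>X \<times> Y. a x * b y) = (\<Sum>x\<in>X. a x) * (\<Sum>y\<in>Y. b y)"
    by (simp add: sum_product sum.cartesian_product)
  also have "\<dots> = ?N * ?N" using Na Nb by simp
  finally have "(\<Sum>(x, y)\<in>A. ln (a x) + ln (b y) - ln ?N) \<le> 0"
    by (cases "card A = 0") (simp_all add: card_eq_0_iff finA)
  moreover have "(\<Sum>(x, y)\<in>A. ln (a x) + ln (b y) - ln ?N)
      = (\<Sum>(x, y)\<in>A. ln (a x)) + (\<Sum>(x, y)\<in>A. ln (b y)) - ?N * ln ?N"
    by (simp add: case_prod_unfold sum_subtractf sum.distrib)
  ultimately show ?thesis using e1 e2 by linarith
qed

text \<open>Read \<open>A\<close> as a set of pairs (value at \<open>i\<close>, remaining tuple).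
  The slice and fibre sizes are its two marginals, so this is subadditivity of entropy for a uniform
  element of \<open>A\<close>.\<close>

lemma sum_slices_fibres_ln_le:
  assumes "finite V" "finite I" "i \<notin> I" "A \<subseteq> insert i I \<rightarrow>\<^sub>E V"
  shows "(\<Sum>v\<in>V. real (card (slice V I i A v)) * ln (real (card (slice V I i A v)))) +
    (\<Sum>y\<in>I \<rightarrow>\<^sub>E V. real (card (fibre V i A y)) * ln (real (card (fibre V i A y))))
    \<le> real (card A) * ln (real (card A))"
proof -
  let ?B = "{(v, y). v \<in> V \<and> y \<in> I \<rightarrow>\<^sub>E V \<and> y(i := v) \<in> A}"
  have fin: "finite (I \<rightarrow>\<^sub>E V)" using assms by (auto intro!: finite_PiE)
  have "?B = (SIGMA v:V. slice V I i A v)" by (auto simp: slice_def)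
  then have "card ?B = (\<Sum>v\<in>V. card (slice V I i A v))"
    using assms(1) fin by (simp add: card_SigmaI slice_def)
  also have "\<dots> = card A" using sum_slices[OF assms, of "\<lambda>_. 1::nat"] by simp
  finally have B: "card ?B = card A" .
  have 1: "{y \<in> I \<rightarrow>\<^sub>E V. (v, y) \<in> ?B} = slice V I i A v" if "v \<in> V" for v
    using that by (auto simp: slice_def)
  have 2: "{v \<in> V. (v, y) \<in> ?B} = fibre V i A y" if "y \<in> I \<rightarrow>\<^sub>E V" for y
    using that by (auto simp: fibre_def)
  have "?B \<subseteq> V \<times> (I \<rightarrow>\<^sub>E V)" by auto
  from sum_marginals_ln_le[OF assms(1) fin this] show ?thesis
    by (simp only: 1 2 B cong: sum.cong)
qed

text \<open>Slices and fibres each partition \<open>A\<close>, so the term with ln m splits exactly: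
  a share \<open>card I\<close> goes to the slices and a share 1 to the fibres. Only the terms |A|
  ln |A| need an inequality, in the direction that \<open>c\<close> being nonnegative preserves.
  Empty slices and fibres are harmless because of the factor \<open>card\<close>.\<close>

theorem power_boundary_log_isoperimetry:
  fixes c :: real
  assumes G: "finite_simple_graph G" and "verts G \<noteq> {}" and "c \<ge> 0"
    and iso: "\<And>S. S \<subseteq> verts G \<Longrightarrow>
      c * card S * (ln (card (verts G)) - ln (card S)) \<le> edge_boundary G S"
    and "finite I" "A \<subseteq> I \<rightarrow>\<^sub>E verts G"
  shows "c * card A * (card I * ln (card (verts G)) - ln (card A)) \<le> power_boundary G I A"
  using assms(5,6)
proof (induction I arbitrary: A rule: finite_induct)
  case empty
  then have "A = {} \<or> A = {\<lambda>_. undefined}" by auto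
  then show ?case by (auto simp: power_boundary_def)
next
  case (insert i I)
  let ?V = "verts G"
  let ?s = "\<lambda>v. real (card (slice ?V I i A v))" and ?f = "\<lambda>y. real (card (fibre ?V i A y))"
  let ?M = "ln (real (card ?V))"
  have fin: "finite ?V" using G by (auto simp: finite_simple_graph_def)
  note A = insert.prems
  note hyps = fin insert.hyps(1,2) A
  have cs: "real (card A) = (\<Sum>v\<in>?V. ?s v)"
    using sum_slices[OF hyps, of "\<lambda>_. 1::real"] by simp
  have cf: "real (card A) = (\<Sum>y\<in>I \<rightarrow>\<^sub>E ?V. ?f y)"
    using sum_fibres[OF hyps, of "\<lambda>_. 1::real"] by simp
  have "c * card A * (card (insert i I) * ?M - ln (card A))
      = c * (card A * (card I * ?M) + card A * ?M - card A * ln (card A))"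
    using insert.hyps by (simp add: algebra_simps)
  also have "\<dots> \<le> c * (card A * (card I * ?M) + card A * ?M
      - ((\<Sum>v\<in>?V. ?s v * ln (?s v)) + (\<Sum>y\<in>I \<rightarrow>\<^sub>E ?V. ?f y * ln (?f y))))"
    using sum_slices_fibres_ln_le[OF hyps] \<open>c \<ge> 0\<close> by (intro mult_left_mono) auto
  also have "\<dots> = (\<Sum>v\<in>?V. c * ?s v * (card I * ?M - ln (?s v)))
      + (\<Sum>y\<in>I \<rightarrow>\<^sub>E ?V. c * ?f y * (?M - ln (?f y)))"
  proof -
    have "card A * (card I * ?M) = (\<Sum>v\<in>?V. ?s v * (card I * ?M))"
      unfolding cs by (simp add: sum_distrib_right)
    moreover have "card A * ?M = (\<Sum>y\<in>I \<rightarrow>\<^sub>E ?V. ?f y * ?M)"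
      unfolding cf by (simp add: sum_distrib_right)
    ultimately show ?thesis
      by (simp add: right_diff_distrib sum_subtractf distrib_left sum_distrib_left mult.assoc)
  qed
  also have "\<dots> \<le> (\<Sum>v\<in>?V. real (power_boundary G I (slice ?V I i A v)))
      + (\<Sum>y\<in>I \<rightarrow>\<^sub>E ?V. real (edge_boundary G (fibre ?V i A y)))"
    by (intro add_mono sum_mono insert.IH iso) (auto simp: slice_def fibre_def)
  also have "\<dots> = power_boundary G (insert i I) A"
    by (simp add: power_boundary_insert[OF G insert.hyps(1,2) A])
  finally show ?case .
qed

section \<open>Product sets and the cost of extra vertices\<close>

text \<open>The set is \<open>T\<close> times a power of \<open>S\<close>: boundary per vertex is
  additive under products. An extremal \<open>S\<close> with an adjustable \<open>T\<close> builds
  the counterexample; \<open>S\<close> equal to the whole vertex set, which has no boundary, carries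
  it to higher dimensions.\<close>

lemma exists_product_with_power:
  assumes G: "finite_simple_graph G" and S: "S \<subseteq> verts G" "S \<noteq> {}"
    and "finite J" "finite I" "I \<inter> J = {}" "T \<subseteq> I \<rightarrow>\<^sub>E verts G"
  shows "\<exists>A \<subseteq> I \<union> J \<rightarrow>\<^sub>E verts G. card A = card S ^ card J * card T \<and>
    real (power_boundary G (I \<union> J) A) = card S ^ card J *
      (power_boundary G I T + card J * card T * (edge_boundary G S / card S))"
  using assms(4,6)
proof (induction J rule: finite_induct)
  case empty
  then show ?case using assms(7) by auto
next
  case (insert i J)
  let ?V = "verts G"
  have fin: "finite ?V" using G by (auto simp: finite_simple_graph_def)
  then have finS: "finite S" "card S > 0" using S finite_subset card_gt_0_iff by blast+
  let ?K = "I \<union> J"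
  have K: "finite ?K" "i \<notin> ?K" using insert assms(5) by auto
  from insert obtain A where A: "A \<subseteq> ?K \<rightarrow>\<^sub>E ?V" "card A = card S ^ card J * card T"
      "real (power_boundary G ?K A) = card S ^ card J *
        (power_boundary G I T + card J * card T * (edge_boundary G S / card S))"
    by auto
  let ?B = "(\<lambda>(v, y). y(i := v)) ` (S \<times> A)"
  have B: "?B \<subseteq> insert i ?K \<rightarrow>\<^sub>E ?V"
    using A(1) S(1) unfolding PiE_insert_eq by (intro image_mono Sigma_mono)
  have inj: "inj_on (\<lambda>(v, y). y(i := v)) (?V \<times> (?K \<rightarrow>\<^sub>E ?V))"
    by (rule inj_combinator[OF K(2)])
  have mem: "y(i := v) \<in> ?B \<longleftrightarrow> v \<in> S \<and> y \<in> A" if "v \<in> ?V" "y \<in> ?K \<rightarrow>\<^sub>E ?V" for v y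
    using inj_on_image_mem_iff[OF inj _ Sigma_mono[OF S(1) A(1)], of "(v, y)"] that by simp
  have sl: "slice ?V ?K i ?B v = (if v \<in> S then A else {})" if "v \<in> ?V" for v
  proof -
    have "slice ?V ?K i ?B v = {y \<in> ?K \<rightarrow>\<^sub>E ?V. v \<in> S \<and> y \<in> A}"
      unfolding slice_def using mem[OF that] by (intro Collect_cong conj_cong refl)
    then show ?thesis using A(1) by auto
  qed
  have fb: "fibre ?V i ?B y = (if y \<in> A then S else {})" if "y \<in> ?K \<rightarrow>\<^sub>E ?V" for y
  proof -
    have "fibre ?V i ?B y = {v \<in> ?V. v \<in> S \<and> y \<in> A}"
      unfolding fibre_def using mem[OF _ that] by (intro Collect_cong conj_cong refl)
    then show ?thesis using S(1) by auto
  qed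
  have "card ?B = card (S \<times> A)"
    by (rule card_image, rule inj_on_subset[OF inj]) (use A S in auto)
  then have cB: "card ?B = card S * card A" by (simp add: card_cartesian_product)
  have finK: "finite (?K \<rightarrow>\<^sub>E ?V)" using fin K by (auto intro!: finite_PiE)
  have "power_boundary G (insert i ?K) ?B
      = (\<Sum>v\<in>?V. if v \<in> S then power_boundary G ?K A else 0)
      + (\<Sum>y\<in>?K \<rightarrow>\<^sub>E ?V. if y \<in> A then edge_boundary G S else 0)"
  proof -
    have "power_boundary G ?K {} = 0" "edge_boundary G {} = 0"
      by (auto simp: power_boundary_def edge_boundary_def)
    then show ?thesis
      unfolding power_boundary_insert[OF G K B]
      by (intro arg_cong2[where f = "(+)"] sum.cong) (auto simp: sl fb)
  qed
  also have "\<dots> = card S * power_boundary G ?K A + card A * edge_boundary G S"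
  proof -
    have "?V \<inter> S = S" "(?K \<rightarrow>\<^sub>E ?V) \<inter> A = A" using S(1) A(1) by auto
    then show ?thesis using fin finK by (simp flip: sum.inter_restrict)
  qed
  finally have pB: "real (power_boundary G (insert i ?K) ?B) =
      card S * real (power_boundary G ?K A) + real (card A) * edge_boundary G S"
    by simp
  have "real (power_boundary G (I \<union> insert i J) ?B) = card S ^ card (insert i J) *
      (power_boundary G I T + card (insert i J) * card T * (edge_boundary G S / card S))"
    using pB finS S(2) insert.hyps unfolding A(3) A(2) by (simp add: field_simps)
  then show ?case
    using B cB A(2) insert.hyps by (intro exI[of _ ?B]) (auto simp: mult.assoc)
qed

lemma out_degree_le:
  assumes "finite_simple_graph G" "regular_graph d G" "v \<in> verts G"
  shows "card {w. {v, w} \<in> edges G \<and> P w} \<le> d"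
proof -
  have "finite {w. {v, w} \<in> edges G}"
    by (rule finite_subset[of _ "verts G"]) (use assms(1) in \<open>auto simp: finite_simple_graph_def\<close>)
  then have "card {w. {v, w} \<in> edges G \<and> P w} \<le> card {w. {v, w} \<in> edges G}"
    by (intro card_mono) auto
  then show ?thesis using assms(2,3) by (simp add: regular_graph_def)
qed

text \<open>Enlarging the set creates no new boundary at old vertices, and a new vertex contributes
  at most its full degree \<open>d * card I\<close>.\<close>

lemma power_boundary_Un_le:
  assumes G: "finite_simple_graph G" "regular_graph d G"
    and "finite I" "A \<subseteq> I \<rightarrow>\<^sub>E verts G" "R \<subseteq> I \<rightarrow>\<^sub>E verts G" "A \<inter> R = {}"
  shows "power_boundary G I (A \<union> R) \<le> power_boundary G I A + d * card I * card R"
proof -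
  have fin: "finite (verts G)" using G(1) by (auto simp: finite_simple_graph_def)
  then have "finite (I \<rightarrow>\<^sub>E verts G)" using assms(3) by (auto intro!: finite_PiE)
  then have fins: "finite A" "finite R" using assms(4,5) finite_subset by blast+
  let ?g = "\<lambda>B x i. card {w. {x i, w} \<in> edges G \<and> x(i := w) \<notin> B}"
  have "power_boundary G I (A \<union> R) = (\<Sum>x\<in>A. \<Sum>i\<in>I. ?g (A \<union> R) x i) + (\<Sum>x\<in>R. \<Sum>i\<in>I. ?g (A \<union> R) x i)"
    unfolding power_boundary_def using fins assms(6) by (rule sum.union_disjoint)
  also have "\<dots> \<le> (\<Sum>x\<in>A. \<Sum>i\<in>I. ?g A x i) + (\<Sum>x\<in>R. \<Sum>i\<in>I. d)"
  proof (intro add_mono sum_mono)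
    fix x i
    have "finite {w. {x i, w} \<in> edges G \<and> x(i := w) \<notin> A}"
      by (rule finite_subset[OF _ fin]) (use G(1) in \<open>auto simp: finite_simple_graph_def\<close>)
    then show "?g (A \<union> R) x i \<le> ?g A x i" by (rule card_mono) auto
  next
    fix x i assume "x \<in> R" "i \<in> I"
    then show "?g (A \<union> R) x i \<le> d" using assms(5) by (intro out_degree_le[OF G]) auto
  qed
  also have "\<dots> = power_boundary G I A + d * card I * card R"
    by (simp add: power_boundary_def algebra_simps)
  finally show ?thesis .
qed

lemma power_boundary_le:
  assumes "finite_simple_graph G" "regular_graph d G" "finite I" "R \<subseteq> I \<rightarrow>\<^sub>E verts G"
  shows "power_boundary G I R \<le> d * card I * card R"
  using power_boundary_Un_le[OF assms(1-3), of "{}" R] assms(4) by (simp add: power_boundary_def)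

section \<open>The sets B_t\<close>

lemma card_fixed_prefix:
  assumes "u \<in> verts G" "t \<le> n"
  shows "card (fixed_prefix G u n t) = card (verts G) ^ (n - t)"
proof -
  have "fixed_prefix G u n t = (\<Pi>\<^sub>E i\<in>{1..n}. if i \<le> t then {u} else verts G)"
    using assms by (auto simp: fixed_prefix_def PiE_iff extensional_def split: if_splits)
  then have "card (fixed_prefix G u n t) = (\<Prod>i\<in>{1..n}. if i \<le> t then 1 else card (verts G))"
    by (simp add: card_PiE if_distrib cong: if_cong)
  also have "\<dots> = (\<Prod>i\<in>{i \<in> {1..n}. \<not> i \<le> t}. card (verts G))"
    unfolding prod.inter_filter[OF finite_atLeastAtMost] by (rule prod.cong) auto
  also have "{i \<in> {1..n}. \<not> i \<le> t} = {t<..n}" by auto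
  finally show ?thesis by simp
qed

text \<open>From a vertex of B_t, all \<open>d\<close> edges in each of the first \<open>t\<close>
  directions leave the set, as there are no loops at \<open>u\<close>, and no edge in another
  direction does.\<close>

lemma edge_boundary_fixed_prefix:
  assumes G: "finite_simple_graph G" "regular_graph d G" and u: "u \<in> verts G" and "t \<le> n"
  shows "edge_boundary (graph_power G n) (fixed_prefix G u n t) = d * t * card (verts G) ^ (n - t)"
proof -
  let ?B = "fixed_prefix G u n t"
  have edge: "\<And>e. e \<in> edges G \<Longrightarrow> e \<subseteq> verts G \<and> card e = 2"
    using G(1) by (auto simp: finite_simple_graph_def)
  have loopless: "{v, v} \<notin> edges G" for v using edge[of "{v, v}"] by auto
  have "card {w. {x i, w} \<in> edges G \<and> x(i := w) \<notin> ?B} = (if i \<le> t then d else 0)"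
    if "x \<in> ?B" "i \<in> {1..n}" for x i
  proof (cases "i \<le> t")
    case True
    then have "x i = u" using that by (auto simp: fixed_prefix_def)
    then have "{w. {x i, w} \<in> edges G \<and> x(i := w) \<notin> ?B} = {w. {u, w} \<in> edges G}"
      using True that loopless by (auto simp: fixed_prefix_def)
    then show ?thesis using True G(2) u by (simp add: regular_graph_def)
  next
    case False
    have "x(i := w) \<in> ?B" if "{x i, w} \<in> edges G" for w
      using edge[OF that] False \<open>x \<in> ?B\<close> \<open>i \<in> {1..n}\<close>
      by (auto simp: fixed_prefix_def PiE_def extensional_def Pi_def)
    then have *: "{w. {x i, w} \<in> edges G \<and> x(i := w) \<notin> ?B} = {}" by blast
    show ?thesis using False by (simp only: * card.empty if_False)
  qed
  then have "power_boundary G {1..n} ?B = (\<Sum>x\<in>?B. \<Sum>i\<in>{1..n}. if i \<le> t then d else 0)"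
    unfolding power_boundary_def by simp
  also have "(\<Sum>i\<in>{1..n}. if i \<le> t then d else 0) = (\<Sum>i\<in>{i \<in> {1..n}. i \<le> t}. d)"
    by (rule sum.inter_filter[symmetric]) simp
  also have "{i \<in> {1..n}. i \<le> t} = {1..t}" using assms(4) by auto
  finally have "power_boundary G {1..n} ?B = d * t * card (verts G) ^ (n - t)"
    using card_fixed_prefix[OF u assms(4)] by (simp add: algebra_simps)
  moreover have "?B \<subseteq> verts (graph_power G n)" by (auto simp: fixed_prefix_def graph_power_def)
  ultimately show ?thesis by (simp add: edge_boundary_graph_power[OF G(1)])
qed

section \<open>The constant y_G as a minimal ratio\<close>

lemma k_star_properties:
  assumes "card (verts G) \<ge> 2"
  shows "k_star G \<in> {1..card (verts G) - 1}"
    and "\<And>j. j \<in> {1..card (verts G) - 1} \<Longrightarrow> iso_slope G j \<le> iso_slope G (k_star G)"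
proof -
  let ?K = "{1..card (verts G) - 1}"
  have "Max (iso_slope G ` ?K) \<in> iso_slope G ` ?K"
    using assms by (intro Max_in) auto
  then obtain k where "k \<in> ?K" "iso_slope G k = Max (iso_slope G ` ?K)" by auto
  then have "\<exists>k. k \<in> ?K \<and> (\<forall>j \<in> ?K. iso_slope G j \<le> iso_slope G k)" by auto
  then have *: "k_star G \<in> ?K \<and> (\<forall>j \<in> ?K. iso_slope G j \<le> iso_slope G (k_star G))"
    unfolding k_star_def by (rule LeastI_ex)
  show "k_star G \<in> ?K" using * by blast
  show "\<And>j. j \<in> ?K \<Longrightarrow> iso_slope G j \<le> iso_slope G (k_star G)" using * by blast
qed

lemma y_intercept_eq: "y_intercept G = - iso_slope G (k_star G) * ln (card (verts G))"
  by (simp add: y_intercept_def iso_line_def iso_slope_def)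

lemma y_intercept_le:
  assumes G: "finite_simple_graph G" and S: "S \<subseteq> verts G" and "card (verts G) \<ge> 2"
  shows "y_intercept G / ln (card (verts G)) * card S * (ln (card (verts G)) - ln (card S))
    \<le> edge_boundary G S"
proof -
  let ?m = "card (verts G)"
  have fin: "finite (verts G)" using G by (auto simp: finite_simple_graph_def)
  have lnm: "ln (real ?m) > 0" using assms(3) by simp
  have le: "card S \<le> ?m" using S fin card_mono by blast
  \<comment> \<open>For the sizes 0 and m the left side is 0; for all others the maximality of the
    slope at \<open>k_star G\<close> applies.\<close>
  consider "card S = 0" | "card S = ?m" | "card S \<in> {1..?m - 1}" using le by force
  then show ?thesis
  proof cases
    case 3
    let ?k = "card S"
    have k: "0 < real ?k" "real ?k < real ?m" using 3 by auto
    then have pos: "ln (real ?m) - ln (real ?k) > 0" by simp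
    have "iso_const G ?k \<le> edge_boundary G S / ?k"
      unfolding iso_const_def using fin S by (intro Min_le) auto
    then have 1: "iso_const G ?k * ?k \<le> edge_boundary G S"
      using k by (simp add: field_simps)
    have "y_intercept G / ln ?m = - iso_slope G (k_star G)"
      using lnm by (simp add: y_intercept_eq)
    also have "\<dots> \<le> - iso_slope G ?k" using k_star_properties(2)[OF assms(3) 3] by simp
    finally have "y_intercept G / ln ?m \<le> iso_const G ?k / (ln ?m - ln ?k)"
      by (simp add: iso_slope_def)
    then have "y_intercept G / ln ?m * (ln ?m - ln ?k) \<le> iso_const G ?k"
      using pos by (simp add: pos_le_divide_eq)
    then have "y_intercept G / ln ?m * (ln ?m - ln ?k) * ?k \<le> iso_const G ?k * ?k"
      by (rule mult_right_mono) simp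
    with 1 show ?thesis by (simp add: mult_ac)
  qed simp_all
qed

text \<open>A set attaining the minimum in \<open>iso_const\<close> at \<open>k_star G\<close> gives
  equality in \<open>y_intercept_le\<close>.\<close>

lemma y_intercept_attained:
  assumes G: "finite_simple_graph G" and "card (verts G) \<ge> 2"
  obtains S where "S \<subseteq> verts G" "card S \<in> {1..card (verts G) - 1}"
    "edge_boundary G S / card S * ln (card (verts G))
      = y_intercept G * (ln (card (verts G)) - ln (card S))"
proof -
  let ?m = "card (verts G)" and ?k = "k_star G"
  have fin: "finite (verts G)" using G by (auto simp: finite_simple_graph_def)
  have k: "?k \<in> {1..?m - 1}" using k_star_properties(1)[OF assms(2)] .
  let ?F = "{A. A \<subseteq> verts G \<and> card A = ?k}"
  have "?k \<le> ?m" using k by auto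
  then obtain A where "A \<subseteq> verts G" "card A = ?k" using obtain_subset_with_card_n by metis
  then have "?F \<noteq> {}" by blast
  moreover have "finite ?F" using fin by simp
  ultimately have "iso_const G ?k \<in> (\<lambda>A. real (edge_boundary G A) / real (card A)) ` ?F"
    unfolding iso_const_def by (intro Min_in) auto
  then obtain S where S: "S \<subseteq> verts G" "card S = ?k" "iso_const G ?k = edge_boundary G S / card S"
    by auto
  have "ln (real ?k) < ln (real ?m)" using k by auto
  then have "iso_const G ?k * ln ?m = y_intercept G * (ln ?m - ln ?k)"
    by (simp add: y_intercept_eq iso_slope_def)
  with S k show thesis using that by metis
qed

section \<open>Sufficiency and necessity of y_G = d\<close>

text \<open>At size m^(n-t) the deficit n ln m - ln |A| is t ln m, so the constant d / ln m yields
  the lower bound d t |A|, exactly the boundary of B_t.\<close>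

lemma fixed_prefix_optimal:
  assumes G: "finite_simple_graph G" "regular_graph d G" "card (verts G) \<ge> 2" "u \<in> verts G"
    and y: "y_intercept G = d"
    and A: "t \<le> n" "A \<subseteq> verts (graph_power G n)" "card A = card (verts G) ^ (n - t)"
  shows "edge_boundary (graph_power G n) (fixed_prefix G u n t) \<le> edge_boundary (graph_power G n) A"
proof -
  let ?m = "card (verts G)"
  have lnm: "ln (real ?m) > 0" using G(3) by simp
  have "d / ln ?m * card A * (card {1..n} * ln ?m - ln (card A)) \<le> power_boundary G {1..n} A"
  proof (rule power_boundary_log_isoperimetry[OF G(1)])
    show "verts G \<noteq> {}" using G(4) by auto
    show "d / ln ?m \<ge> 0" using lnm by simp
    show "d / ln ?m * card S * (ln ?m - ln (card S)) \<le> edge_boundary G S" if "S \<subseteq> verts G" for S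
      using y_intercept_le[OF G(1) that G(3)] y by simp
    show "A \<subseteq> {1..n} \<rightarrow>\<^sub>E verts G" using A(2) by (simp add: graph_power_def)
  qed simp
  also have "card {1..n} * ln ?m - ln (card A) = t * ln ?m"
    using A(1) G(3) by (simp add: A(3) ln_realpow of_nat_diff algebra_simps)
  also have "d / ln ?m * card A * (t * ln ?m) = real (d * t * ?m ^ (n - t))"
    using lnm by (simp add: A(3))
  finally have "d * t * ?m ^ (n - t) \<le> power_boundary G {1..n} A" by linarith
  then show ?thesis
    by (simp add: edge_boundary_fixed_prefix[OF G(1,2,4) A(1)] edge_boundary_graph_power[OF G(1) A(2)])
qed


text \<open>Let \<open>S\<close> attain \<open>y_intercept G\<close>. Per vertex, \<open>S\<^sup>a \<times> V\<^sup>b\<close> has boundary \<open>a e(S) / |S|\<close>, which is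
  \<open>t y_intercept G\<close> if its density \<open>(|S| / m)\<^sup>a\<close> is \<open>m\<^sup>-\<^sup>t\<close>. To reach the size \<open>m\<^sup>a\<^sup>+\<^sup>b\<^sup>-\<^sup>t\<close> exactly,
  replace \<open>V\<^sup>b\<close> by a subset \<open>T\<close> of suitable size, and add fewer than \<open>|S|\<^sup>a\<close> arbitrary
  vertices; for a large fixed \<open>b\<close> their contribution is negligible as \<open>t\<close> grows.\<close>

lemma exists_smaller_boundary:
  assumes G: "finite_simple_graph G" "regular_graph d G" "card (verts G) \<ge> 2"
    and y: "y_intercept G < d"
  shows "\<exists>N t A. t \<in> {1..N} \<and> A \<subseteq> {1..N} \<rightarrow>\<^sub>E verts G \<and> card A = card (verts G) ^ (N - t) \<and>
    power_boundary G {1..N} A < d * t * card (verts G) ^ (N - t)"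
proof -
  let ?V = "verts G" and ?m = "card (verts G)"
  have fin: "finite ?V" using G by (auto simp: finite_simple_graph_def)
  obtain S where S: "S \<subseteq> ?V" "card S \<in> {1..?m - 1}"
    "edge_boundary G S / card S * ln ?m = y_intercept G * (ln ?m - ln (card S))"
    using y_intercept_attained[OF G(1,3)] .
  define k where "k = card S"
  define e where "e = edge_boundary G S / card S"
  \<comment> \<open>The real solution of (k / m)^x = m^(-t) is x = t L: each fixed coordinate of B_t
    is traded for \<open>L\<close> factors \<open>S\<close>.\<close>
  define L where "L = ln ?m / (ln ?m - ln k)"
  define \<epsilon> where "\<epsilon> = d - y_intercept G"
  have \<epsilon>: "\<epsilon> > 0" using y by (simp add: \<epsilon>_def)
  have k: "1 \<le> k" "k < ?m" using S(2) by (auto simp: k_def)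
  have lnk: "0 \<le> ln (real k)" "ln (real k) < ln (real ?m)" using k by auto
  have gap: "ln (real ?m) - ln (real k) > 0" using lnk by simp
  have L1: "L \<ge> 1" using lnk by (simp add: L_def)
  have eL: "e * L = y_intercept G"
  proof -
    have "e * L = e * ln ?m / (ln ?m - ln k)" by (simp add: L_def)
    also have "\<dots> = y_intercept G" using S(3) gap by (simp add: e_def k_def)
    finally show ?thesis .
  qed
  have e0: "e \<ge> 0" by (simp add: e_def)
  \<comment> \<open>There will be at most M / m^c leftover vertices, each costing about d a <= d t
    L; this \<open>c\<close> keeps that total below half of the gain
    \<open>\<epsilon> * t * M\<close>.\<close>
  obtain c where c: "2 * d * L / \<epsilon> < real ?m ^ c"
    using real_arch_pow[of "real ?m" "2 * d * L / \<epsilon>"] G(3) by auto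
  then have c': "2 * d * L \<le> \<epsilon> * real ?m ^ c" using \<epsilon> by (simp add: field_simps)
  \<comment> \<open>The additional coordinate absorbs the factor m that may be lost in rounding
    \<open>a\<close> down; see \<open>high\<close>.\<close>
  define b where "b = Suc c"
  \<comment> \<open>The cost d b per vertex is paid twice, for the boundary of \<open>T\<close> and
    for the leftover vertices; both together must stay below the other half of the gain.\<close>
  obtain t where t: "4 * d * b / \<epsilon> < real t" using reals_Archimedean2 by blast
  then have "0 < real t" by (rule le_less_trans[rotated]) (use \<epsilon> in simp)
  then have t1: "t \<ge> 1" by simp
  have t': "4 * d * b < \<epsilon> * t" using t \<epsilon> by (simp add: field_simps)
  \<comment> \<open>Rounding down keeps the density of the power of \<open>S\<close> at least m^(-t)
    (\<open>low\<close>), so that \<open>T\<close> fits into \<open>b\<close> free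
    coordinates.\<close>
  define a where "a = nat \<lfloor>t * L\<rfloor>"
  have tL: "t \<le> t * L" using L1 by (simp add: mult_le_cancel_left1)
  have a: "a \<le> t * L" "t * L < a + 1"
    using tL by (auto simp: a_def) linarith+
  have ta: "t \<le> a" using tL by (simp add: a_def le_nat_floor)
  have tgap: "t * L * (ln ?m - ln k) = t * ln ?m" using gap by (simp add: L_def)
  have ln_le: "x \<le> y" if "ln (real x) \<le> ln (real y)" "x > 0" "y > 0" for x y :: nat
    using that by simp
  have pos: "?m ^ a > 0" "?m ^ (a + 1) > 0" "k ^ a * ?m ^ t > 0" using k by auto
  have ln_pow: "ln (real (k ^ a * ?m ^ t)) = a * ln k + t * ln ?m" "ln (real (?m ^ i)) = i * ln ?m" for i
    using k by (simp_all add: ln_mult ln_realpow)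
  have "a * (ln ?m - ln k) \<le> t * ln ?m"
    using mult_right_mono[OF a(1) less_imp_le[OF gap]] unfolding tgap .
  then have low: "?m ^ a \<le> k ^ a * ?m ^ t"
    by (intro ln_le pos) (simp add: ln_pow algebra_simps del: of_nat_mult of_nat_power)
  have "t * ln ?m \<le> (a + 1) * (ln ?m - ln k)"
    using mult_right_mono[OF less_imp_le[OF a(2)] less_imp_le[OF gap]] unfolding tgap .
  then have "a * ln k + t * ln ?m \<le> (a + 1) * ln ?m"
    using lnk(1) by (simp add: algebra_simps)
  then have high: "k ^ a * ?m ^ t \<le> ?m ^ (a + 1)"
    by (intro ln_le pos) (simp only: ln_pow of_nat_add of_nat_1)
  define M where "M = ?m ^ (a + b - t)"
  \<comment> \<open>\<open>q\<close> will be the size of \<open>T\<close>, and \<open>r\<close> the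
    number of leftover vertices.\<close>
  define q where "q = M div k ^ a"
  define r where "r = M mod k ^ a"
  have Mqr: "M = k ^ a * q + r" by (simp add: q_def r_def)
  have Mt: "M * ?m ^ t = ?m ^ (a + b)"
    using ta by (simp add: M_def flip: power_add)
  have m0: "?m ^ t > 0" using k by simp
  have "M * ?m ^ t \<le> (k ^ a * ?m ^ b) * ?m ^ t"
    using mult_right_mono[OF low, of "?m ^ b"] by (simp add: Mt power_add mult_ac)
  then have "M \<le> k ^ a * ?m ^ b" using m0 mult_le_cancel2 by blast
  then have qle: "q \<le> ?m ^ b"
    unfolding q_def using k by (metis div_le_mono nonzero_mult_div_cancel_left not_one_le_zero power_not_zero)
  have "(k ^ a * ?m ^ c) * ?m ^ t \<le> M * ?m ^ t"
    using mult_right_mono[OF high, of "?m ^ c"] by (simp add: Mt b_def power_add mult_ac)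
  then have "k ^ a * ?m ^ c \<le> M" using m0 mult_le_cancel2 by blast
  moreover have "r \<le> k ^ a" using k by (simp add: r_def less_imp_le)
  ultimately have rM: "r * ?m ^ c \<le> M" by (meson le_trans mult_le_mono1)
  let ?I = "{1..b}" and ?J = "{b+1..b+a}"
  have IJ: "?I \<union> ?J = {1..b+a}" by auto
  have "q \<le> card (?I \<rightarrow>\<^sub>E ?V)" using qle by (simp add: card_PiE)
  then obtain T where T: "T \<subseteq> ?I \<rightarrow>\<^sub>E ?V" "card T = q" using obtain_subset_with_card_n by metis
  have "S \<noteq> {}" using S(2) by auto
  then obtain A1 where A1: "A1 \<subseteq> {1..b+a} \<rightarrow>\<^sub>E ?V" "card A1 = k ^ a * q"
      "real (power_boundary G {1..b+a} A1) = k ^ a * (power_boundary G ?I T + a * q * e)"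
    using exists_product_with_power[OF G(1) S(1), of ?J ?I T] T
    unfolding IJ k_def e_def by auto
  let ?W = "{1..b+a} \<rightarrow>\<^sub>E ?V"
  have finW: "finite ?W" using fin by (auto intro!: finite_PiE)
  have "M \<le> card ?W" using k by (simp add: M_def card_PiE power_increasing)
  then have "r \<le> card (?W - A1)"
    using A1 finW Mqr by (simp add: card_Diff_subset finite_subset[OF A1(1) finW])
  then obtain R where R: "R \<subseteq> ?W - A1" "card R = r" using obtain_subset_with_card_n by metis
  have disj: "A1 \<inter> R = {}" "R \<subseteq> ?W" using R by auto
  let ?A = "A1 \<union> R"
  have cA: "card ?A = M"
    using disj A1 R finW Mqr by (subst card_Un_disjoint) (auto intro: finite_subset)
  have "real (power_boundary G {1..b+a} ?A)
      \<le> real (power_boundary G {1..b+a} A1) + d * (b + a) * r"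
  proof -
    have "power_boundary G {1..b+a} ?A \<le> power_boundary G {1..b+a} A1 + d * (b + a) * r"
      using power_boundary_Un_le[OF G(1,2) _ A1(1) disj(2,1)] R(2) by simp
    then show ?thesis by (simp flip: of_nat_add of_nat_mult)
  qed
  also have "real (power_boundary G {1..b+a} A1) \<le> M * (d * b + t * y_intercept G)"
  proof -
    have "real (power_boundary G ?I T) \<le> d * b * q"
      using power_boundary_le[OF G(1,2) _ T(1)] T(2) by (simp flip: of_nat_mult)
    then have "real (power_boundary G {1..b+a} A1) \<le> k ^ a * (d * b * q + a * q * e)"
      unfolding A1(3) by (intro mult_left_mono) auto
    also have "\<dots> = real (k ^ a * q) * (d * b + a * e)" by (simp add: algebra_simps)
    also have "\<dots> \<le> M * (d * b + a * e)" using Mqr e0 by (intro mult_right_mono) auto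
    also have "a * e \<le> t * L * e" using a(1) e0 by (rule mult_right_mono)
    also have "t * L * e = t * y_intercept G" using eL by (simp add: mult_ac)
    finally show ?thesis by (simp add: mult_left_mono)
  qed
  \<comment> \<open>The part with \<open>a\<close> grows with \<open>t\<close> and needs the strong
    bound \<open>rM\<close>; for the part with \<open>b\<close>, r <= M is enough.\<close>
  also have "real (d * (b + a) * r) \<le> M * (\<epsilon> * t / 2 + d * b)"
  proof -
    have "2 * (d * a * r) = a * (2 * d * r)" by (simp add: mult_ac)
    also have "\<dots> \<le> t * L * (2 * d * r)"
      using mult_right_mono[OF a(1), of "2 * d * r"] by simp
    also have "\<dots> = (2 * d * L) * (t * r)" by (simp add: mult_ac)
    also have "\<dots> \<le> (\<epsilon> * real ?m ^ c) * (t * r)" using c' by (intro mult_right_mono) auto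
    also have "\<dots> = \<epsilon> * t * real (r * ?m ^ c)" by (simp add: mult_ac)
    also have "\<dots> \<le> \<epsilon> * t * M" using rM \<epsilon> by (intro mult_left_mono) (auto simp del: of_nat_mult)
    finally have "real (d * a * r) \<le> M * (\<epsilon> * t / 2)" by (simp add: mult_ac)
    moreover have "real (r * (d * b)) \<le> real (M * (d * b))"
      unfolding of_nat_le_iff using Mqr by (intro mult_right_mono) auto
    ultimately show ?thesis by (simp add: algebra_simps)
  qed
  also have "M * (d * b + t * y_intercept G) + M * (\<epsilon> * t / 2 + d * b)
      = M * (t * y_intercept G + 2 * d * b + \<epsilon> * t / 2)"
    by (simp add: algebra_simps)
  also have "\<dots> < M * (t * y_intercept G + \<epsilon> * t)"
    using t' k by (intro mult_strict_left_mono) (auto simp: M_def)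
  also have "\<dots> = real (d * t * M)" by (simp add: \<epsilon>_def algebra_simps)
  finally have "power_boundary G {1..b+a} ?A < d * t * M" by linarith
  moreover have "t \<in> {1..b+a}" using t1 ta by simp
  moreover have "?A \<subseteq> ?W" using A1(1) disj by auto
  ultimately show ?thesis
    using cA by (intro exI[of _ "b+a"] exI[of _ t] exI[of _ ?A]) (simp add: M_def add.commute)
qed

text \<open>A product with n - N full copies of the vertex set multiplies size and boundary of the
  counterexample by m^(n-N). The size and boundary of B_t scale by the same factor, so the same
  \<open>t\<close> works in every dimension n >= N.\<close>

lemma fixed_prefix_not_optimal:
  assumes G: "finite_simple_graph G" "regular_graph d G" "card (verts G) \<ge> 2" "u \<in> verts G"
    and y: "y_intercept G < d"
  shows "\<exists>n\<^sub>0. \<forall>n \<ge> n\<^sub>0. \<exists>t \<in> {1..n}. \<exists>A \<subseteq> verts (graph_power G n).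
    card A = card (verts G) ^ (n - t) \<and>
    edge_boundary (graph_power G n) A < edge_boundary (graph_power G n) (fixed_prefix G u n t)"
proof -
  let ?m = "card (verts G)"
  obtain N t A where A: "t \<in> {1..N}" "A \<subseteq> {1..N} \<rightarrow>\<^sub>E verts G" "card A = ?m ^ (N - t)"
      "power_boundary G {1..N} A < d * t * ?m ^ (N - t)"
    using exists_smaller_boundary[OF G(1-3) y] by blast
  have "\<exists>B \<subseteq> verts (graph_power G n). card B = ?m ^ (n - t) \<and>
      edge_boundary (graph_power G n) B < edge_boundary (graph_power G n) (fixed_prefix G u n t)"
    if n: "n \<ge> N" for n
  proof -
    have IJ: "{1..N} \<union> {N+1..n} = {1..n}" using n by auto
    have m: "?m ^ (n - N) * ?m ^ (N - t) = ?m ^ (n - t)"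
      using n A(1) by (simp flip: power_add)
    have "verts G \<noteq> {}" using G(4) by auto
    then obtain B where B: "B \<subseteq> {1..n} \<rightarrow>\<^sub>E verts G" "card B = ?m ^ (n - t)"
        "real (power_boundary G {1..n} B) = ?m ^ (n - N) * power_boundary G {1..N} A"
      using exists_product_with_power[OF G(1) order_refl, of "{N+1..n}" "{1..N}" A] A(2,3) m
      unfolding IJ by (auto simp: edge_boundary_verts[OF G(1)])
    then have "power_boundary G {1..n} B = ?m ^ (n - N) * power_boundary G {1..N} A"
      by linarith
    also have "\<dots> < ?m ^ (n - N) * (d * t * ?m ^ (N - t))" using A(4) G(3) by simp
    also have "\<dots> = d * t * ?m ^ (n - t)" by (simp flip: m)
    finally have "power_boundary G {1..n} B < d * t * ?m ^ (n - t)" .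
    moreover have "B \<subseteq> verts (graph_power G n)" using B(1) by (simp add: graph_power_def)
    ultimately show ?thesis
      using B(2) A(1) n
      by (intro exI[of _ B])
         (simp add: edge_boundary_graph_power[OF G(1)] edge_boundary_fixed_prefix[OF G(1,2,4)])
  qed
  moreover have "t \<in> {1..n}" if "n \<ge> N" for n using A(1) that by simp
  ultimately show ?thesis by (intro exI[of _ N] allI impI bexI[of _ t]) auto
qed

theorem mainTheorem6:
  fixes G :: "'a ugraph" and m d :: nat and u :: 'a
  assumes "finite_simple_graph G"
    and "connected_graph G"
    and "card (verts G) = m"
    and "m \<ge> 2"
    and "regular_graph d G"
    and "u \<in> verts G"
  shows "(y_intercept G = real d \<longrightarrow>
            (\<forall>n \<ge> 1. \<forall>t \<in> {1..n}. \<forall>A \<subseteq> verts (graph_power G n).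
               card A = m ^ (n - t) \<longrightarrow>
               edge_boundary (graph_power G n) (fixed_prefix G u n t)
                 \<le> edge_boundary (graph_power G n) A)) \<and>
         (y_intercept G < real d \<longrightarrow>
            (\<exists>n\<^sub>0. \<forall>n \<ge> n\<^sub>0. \<exists>t \<in> {1..n}. \<exists>A \<subseteq> verts (graph_power G n).
               card A = m ^ (n - t) \<and>
               edge_boundary (graph_power G n) A
                 < edge_boundary (graph_power G n) (fixed_prefix G u n t)))"
proof (intro conjI impI)
  have m: "card (verts G) \<ge> 2" using assms(3,4) by simp
  show "\<forall>n \<ge> 1. \<forall>t \<in> {1..n}. \<forall>A \<subseteq> verts (graph_power G n). card A = m ^ (n - t) \<longrightarrow>
      edge_boundary (graph_power G n) (fixed_prefix G u n t) \<le> edge_boundary (graph_power G n) A"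
    if "y_intercept G = real d"
    using fixed_prefix_optimal[OF assms(1,5) m assms(6) that] assms(3) by simp
  show "\<exists>n\<^sub>0. \<forall>n \<ge> n\<^sub>0. \<exists>t \<in> {1..n}. \<exists>A \<subseteq> verts (graph_power G n).
      card A = m ^ (n - t) \<and>
      edge_boundary (graph_power G n) A < edge_boundary (graph_power G n) (fixed_prefix G u n t)"
    if "y_intercept G < real d"
    using fixed_prefix_not_optimal[OF assms(1,5) m assms(6) that] unfolding assms(3) .
qed

end
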